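(* Let $A\in\mathbb{X}^{n\times n}$ be a matrix with spectral radius $\lambda>\mathsf{0}$, let $p\in\mathbb{X}^{n}$ be a vector, let $q\in\mathbb{X}^{n}$ be a regular vector, and let $c\in\mathbb{X}$ be a scalar. Consider the problem of minimizing $$x^{-}Ax\oplus x^{-}p\oplus q^{-}x\oplus c$$ over all regular vectors $x\in\mathbb{X}^{n}$. Denote $$\mu=\lambda\oplus\bigoplus_{m=1}^{n}(q^{-}A^{m-1}p)^{1/(m+1)}\oplus c.$$ Then the minimum is equal to $\mu$, and all regular solutions of the problem are given by $$x=(\mu^{-1}A)^{\ast}u,\qquad \mu^{-1}p\leq u\leq\mu\left(q^{-}(\mu^{-1}A)^{\ast}\right)^{-};$$ that is, a regular vector $x\in\mathbb{X}^{n}$ attains the minimum if and only if $x=(\mu^{-1}A)^{\ast}u$ for some $u\in\mathbb{X}^{n}$ satisfying this double inequality.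
   Context: $\langle\mathbb{X},\mathsf{0},\mathsf{1},\oplus,\otimes\rangle$ is an idempotent semifield: $\oplus$ and $\otimes$ are associative and commutative, with neutral elements $\mathsf{0}$ (zero) and $\mathsf{1}$ (identity) respectively; $\otimes$ distributes over $\oplus$ and $\mathsf{0}$ is absorbing for $\otimes$; addition is idempotent ($x\oplus x=x$); every $x\neq\mathsf{0}$ has a multiplicative inverse $x^{-1}$. The sign $\otimes$ is omitted. Integer powers are in the sense of $\otimes$, and the semifield is assumed radicable (powers with rational exponents exist), with $\mathsf{0}^{p}=\mathsf{0}$ for $p>0$. The order is $x\leq y$ iff $x\oplus y=y$, and it is assumed to be total; minimization is with respect to this order. Matrices and vectors over $\mathbb{X}$ are added and multiplied by the usual rules with $\oplus,\otimes$ in place of $+,\times$; $\mathbb{X}^{n}$ is the set of column vectors of order $n$; inequalities between vectors are entrywise. A vector is regular if none of its entries is $\mathsf{0}$. For a nonzero column vector $x=(x_i)$, the multiplicative conjugate transpose $x^{-}=(x_i^{-})$ is the row vector with $x_i^{-}=x_i^{-1}$ if $x_i\neq\mathsf{0}$ and $x_i^{-}=\mathsf{0}$ otherwise; for a nonzero row vector $y$, $y^{-}$ is the column vector defined in the same way. $I$ is the identity matrix ($\mathsf{1}$ on the diagonal, $\mathsf{0}$ elsewhere), $A^{0}=I$, $A^{k}=A^{k-1}A$. For $A=(a_{ij})\in\mathbb{X}^{n\times n}$: $\mathrm{tr}A=a_{11}\oplus\cdots\oplus a_{nn}$ and $A^{\ast}=I\oplus A\oplus\cdots\oplus A^{n-1}$.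 A scalar $\lambda\in\mathbb{X}$ is an eigenvalue of $A$ if $Ax=\lambda x$ for some nonzero $x\in\mathbb{X}^{n}$; the spectral radius of $A$ is its maximal eigenvalue, which is given by $\lambda=\bigoplus_{m=1}^{n}\left(\mathrm{tr}(A^{m})\right)^{1/m}$. *)

theory Defs
  imports "HOL-Analysis.Analysis"
begin

section \<open>Radicable, totally ordered idempotent semifields\<close>

text \<open>
  The class operations \<open>+\<close>, \<open>*\<close>, \<open>0\<close>, \<open>1\<close> stand for idempotent addition, multiplication, zero and
  identity; \<open>\<Sum>\<close> is the iterated idempotent sum and \<open>^\<close> the iterated product.
  Nothing is assumed about \<open>inverse 0\<close>.
\<close>

class idempotent_semifield = comm_semiring_1 + inverse + order +
  assumes add_idem: "x + x = x"
    and inverse_mult_self: "x \<noteq> 0 \<Longrightarrow> inverse x * x = 1"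
    and divide_eq_mult_inverse: "x / y = x * inverse y"
    and le_iff_add_eq: "x \<le> y \<longleftrightarrow> x + y = y"

class radicable_linear_semifield = idempotent_semifield + linorder +
  assumes ex_nth_root: "0 < n \<Longrightarrow> \<exists>y. y ^ n = x"

definition nth_root :: "nat \<Rightarrow> 'a::radicable_linear_semifield \<Rightarrow> 'a"
  where "nth_root n x = (THE y. y ^ n = x)"

text \<open>In a totally ordered idempotent semifield roots are unique, so \<open>nth_root\<close> is well defined.\<close>

lemma semifield_mult_right_mono:
  fixes a b c :: "'a::idempotent_semifield"
  assumes "a \<le> b" shows "a * c \<le> b * c"
  using assms by (simp add: le_iff_add_eq flip: distrib_right)

lemma semifield_zero_le: "(0::'a::idempotent_semifield) \<le> x"
  by (simp add: le_iff_add_eq)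

lemma semifield_power_mono:
  fixes a b :: "'a::idempotent_semifield"
  assumes "a \<le> b" shows "a ^ n \<le> b ^ n"
proof (induction n)
  case (Suc n)
  have "a ^ Suc n \<le> b * a ^ n"
    using semifield_mult_right_mono[OF assms, of "a ^ n"] by simp
  also have "\<dots> \<le> b ^ Suc n"
    using semifield_mult_right_mono[OF Suc.IH, of b] by (simp add: mult.commute)
  finally show ?case .
qed simp

lemma semifield_mult_right_cancel:
  fixes a b c :: "'a::idempotent_semifield"
  assumes "c \<noteq> 0" "a * c = b * c" shows "a = b"
proof -
  have "a * c * inverse c = b * c * inverse c" using assms(2) by simp
  then show ?thesis
    using inverse_mult_self[OF assms(1)] by (simp add: mult.assoc mult.commute[of c])
qed

lemma semifield_power_nonzero:
  fixes a :: "'a::idempotent_semifield"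
  assumes "a \<noteq> 0" shows "a ^ n \<noteq> 0"
proof (induction n)
  case 0
  show ?case using assms by (metis mult_1 mult_zero_left power_0)
next
  case (Suc n)
  then show ?case
    using assms semifield_mult_right_cancel[of "a ^ n" a 0] by auto
qed

lemma semifield_power_less_imp_neq:
  fixes y z :: "'a::idempotent_semifield"
  assumes "0 < n" "y < z" shows "y ^ n \<noteq> z ^ n"
proof
  assume eq: "y ^ n = z ^ n"
  obtain m where n: "n = Suc m" using assms(1) gr0_implies_Suc by blast
  have z: "z \<noteq> 0" using assms(2) semifield_zero_le[of y] by (auto simp: less_le_not_le)
  have "y ^ n \<le> y * z ^ m"
    using semifield_mult_right_mono[OF semifield_power_mono[of y z m], of y] assms(2) n
    by (simp add: mult.commute order.strict_implies_order)
  moreover have "y * z ^ m \<le> z * z ^ m"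
    using assms(2) by (intro semifield_mult_right_mono) simp
  ultimately have "y * z ^ m = z * z ^ m" using eq n by simp
  then show False
    using semifield_mult_right_cancel[OF semifield_power_nonzero[OF z]] assms(2) by blast
qed

lemma nth_root_eqI:
  fixes x y :: "'a::radicable_linear_semifield"
  assumes "0 < n" "y ^ n = x" shows "nth_root n x = y"
  unfolding nth_root_def
proof (rule the_equality)
  show "y ^ n = x" by fact
  show "z = y" if "z ^ n = x" for z
    using that assms semifield_power_less_imp_neq[OF assms(1)] by (metis linorder_neqE)
qed

lemma nth_root_power:
  fixes x :: "'a::radicable_linear_semifield"
  assumes "0 < n" shows "nth_root n x ^ n = x"
  using ex_nth_root[OF assms, of x] nth_root_eqI[OF assms] by metis


section \<open>Vectors and matrices\<close>

text \<open>
  Rows and columns share the type \<^typ>\<open>'a ^ 'n\<close>; a row acts on a matrix by \<open>v*\<close>, a matrix on a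
  column by \<open>*v\<close>, and \<open>row_col y x\<close> is the product of the row \<open>y\<close> and the column \<open>x\<close>.
\<close>

definition row_col :: "'a::comm_semiring_1 ^ 'n \<Rightarrow> 'a ^ 'n \<Rightarrow> 'a"
  where "row_col y x = (\<Sum>i\<in>UNIV. y $ i * x $ i)"

definition regular :: "'a::zero ^ 'n \<Rightarrow> bool"
  where "regular x \<longleftrightarrow> (\<forall>i. x $ i \<noteq> 0)"

text \<open>Multiplicative conjugate transposition, in both directions between rows and columns.\<close>

definition conj_transpose :: "'a::idempotent_semifield ^ 'n \<Rightarrow> 'a ^ 'n"
  where "conj_transpose x = (\<chi> i. if x $ i = 0 then 0 else inverse (x $ i))"

definition scale_mat :: "'a::times \<Rightarrow> 'a ^ 'n ^ 'm \<Rightarrow> 'a ^ 'n ^ 'm"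
  where "scale_mat c A = (\<chi> i j. c * A $ i $ j)"

text \<open>The operator \<open>^\<close> on the type \<open>'a ^ 'n ^ 'n\<close> is the entrywise power, hence a separate
  definition.\<close>

primrec mat_pow :: "'a::semiring_1 ^ 'n ^ 'n \<Rightarrow> nat \<Rightarrow> 'a ^ 'n ^ 'n"
  where
    "mat_pow A 0 = mat 1"
  | "mat_pow A (Suc k) = mat_pow A k ** A"

definition mat_star :: "'a::semiring_1 ^ 'n ^ 'n \<Rightarrow> 'a ^ 'n ^ 'n"
  where "mat_star A = (\<Sum>k<CARD('n). mat_pow A k)"

definition eigenvalue :: "'a::semiring_1 ^ 'n ^ 'n \<Rightarrow> 'a \<Rightarrow> bool"
  where "eigenvalue A l \<longleftrightarrow> (\<exists>x. x \<noteq> 0 \<and> A *v x = l *s x)"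

definition is_spectral_radius :: "'a::idempotent_semifield ^ 'n ^ 'n \<Rightarrow> 'a \<Rightarrow> bool"
  where "is_spectral_radius A l \<longleftrightarrow> eigenvalue A l \<and> (\<forall>k. eigenvalue A k \<longrightarrow> k \<le> l)"

definition objective ::
  "'a::idempotent_semifield ^ 'n ^ 'n \<Rightarrow> 'a ^ 'n \<Rightarrow> 'a ^ 'n \<Rightarrow> 'a \<Rightarrow> 'a ^ 'n \<Rightarrow> 'a"
  where "objective A p q c x =
    row_col (conj_transpose x) (A *v x) + row_col (conj_transpose x) p
      + row_col (conj_transpose q) x + c"

end

theory Submission
  imports Defs
begin

text \<open>
  The objective is a sum of four terms, and in an idempotent semifield a sum is at most \<open>\<theta>\<close> exactly
  if each of its summands is. For regular \<open>x\<close> each of the three conjugate products can be resolved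
  by multiplying out (\<open>row_col_conj_transpose_le_iff\<close>), so that \<open>objective A p q c x \<le> \<theta>\<close> becomes
  the system \<open>A x \<le> \<theta> x\<close>, \<open>p \<le> \<theta> x\<close>, \<open>x \<le> \<theta> q\<close>, \<open>c \<le> \<theta>\<close> of inequalities linear in \<open>x\<close>.

  Every \<open>\<theta>\<close> for which this system has a regular solution is at least \<open>\<mu>\<close>. Comparing \<open>x\<close> with an
  eigenvector gives \<open>lam \<le> \<theta>\<close> (\<open>eigenvalue_le\<close>), and \<open>A^(m-1) p \<le> \<theta> A^(m-1) x \<le> \<theta>^m x \<le> \<theta>^(m+1) q\<close>
  gives the root terms. Therefore \<open>x\<close> is optimal exactly if it solves the system for \<open>\<theta> = \<mu>\<close>.

  With \<open>B = \<mu>^(-1) A\<close> the first inequality of that system reads \<open>B x \<le> x\<close>. Its solutions are the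
  vectors \<open>B* u\<close>: a solution is fixed by the star \<open>B*\<close>, and conversely \<open>B B* \<le> B*\<close>. The latter
  says that \<open>B^n\<close> adds nothing to the sum \<open>I + B + ... + B^(n-1)\<close>. An entry of \<open>B^n\<close> is the weight of
  a walk with \<open>n\<close> steps; such a walk visits some vertex twice, and removing the cycle in between
  leaves a shorter walk whose weight is not smaller, provided that no cycle weighs more than \<open>1\<close>
  (\<open>mat_pow_le_star\<close>).

  That no cycle of \<open>B\<close> is too heavy comes from the assumption on \<open>lam\<close>, which speaks of
  eigenvalues only: the maximal geometric mean \<open>\<kappa>\<close> of the weights of the cycles, unless it is
  zero, is itself an eigenvalue, since a column of \<open>(\<kappa>^(-1) A)*\<close> at a vertex of a cycle of mean
  \<open>\<kappa>\<close> is an eigenvector (\<open>cycle_weight_le\<close>). Hence \<open>\<kappa> \<le> lam \<le> \<mu>\<close>.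

  Finally, the bounds on \<open>u\<close> are the remaining inequalities transported along \<open>x = B* u\<close>, and they
  are consistent because \<open>q^- B* p \<le> \<mu>^2\<close>, which is what the root terms of \<open>\<mu>\<close> ensure.
\<close>

section \<open>Order and sums in idempotent semifields\<close>

text \<open>Since \<open>a + c\<close> is the supremum of \<open>a\<close> and \<open>c\<close>, the elements above \<open>a\<close> are exactly the sums
  \<open>a + c\<close>. This makes the general monotonicity lemmas for sums and products applicable.\<close>

instance idempotent_semifield \<subseteq> canonically_ordered_monoid_add
proof
  show "a \<le> b \<longleftrightarrow> (\<exists>c. b = a + c)" for a b :: 'a
    by (metis add.assoc add_idem le_iff_add_eq)
qed

instance idempotent_semifield \<subseteq> ordered_comm_semiring
proof
  show "c * a \<le> c * b" if "a \<le> b" for a b c :: 'a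
    using semifield_mult_right_mono[OF that, of c] by (simp add: mult.commute)
qed

lemma semifield_add_le_iff:
  fixes x y z :: "'a::idempotent_semifield"
  shows "x + y \<le> z \<longleftrightarrow> x \<le> z \<and> y \<le> z"
  by (metis add.assoc add.commute add_idem le_iff_add_eq)

lemma semifield_sum_le_iff:
  fixes f :: "'b \<Rightarrow> 'a::idempotent_semifield"
  assumes "finite S"
  shows "sum f S \<le> z \<longleftrightarrow> (\<forall>i\<in>S. f i \<le> z)"
  using assms by (induction S) (auto simp: semifield_add_le_iff)

lemma semifield_sum_upper:
  fixes f :: "'b \<Rightarrow> 'a::idempotent_semifield"
  assumes "finite S" "i \<in> S"
  shows "f i \<le> sum f S"
  using semifield_sum_le_iff[OF assms(1), of f "sum f S"] assms(2) by auto

text \<open>Totality of the order enters here: an entry of a matrix product is not only bounded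
  by, but equal to the weight of one of the paths it collects.\<close>

lemma semifield_sum_attained:
  fixes f :: "'b \<Rightarrow> 'a::radicable_linear_semifield"
  assumes "finite S" "S \<noteq> {}"
  shows "\<exists>i\<in>S. sum f S = f i"
  using assms
proof (induction S rule: finite_ne_induct)
  case (insert a S)
  then obtain j where j: "j \<in> S" "sum f S = f j" by blast
  have "f a + f j = f a \<or> f a + f j = f j"
    by (metis add.commute le_iff_add_eq linear)
  then show ?case using insert j by auto
qed simp

lemma inverse_mult_le_iff:
  fixes a b c :: "'a::idempotent_semifield"
  assumes "a \<noteq> 0"
  shows "inverse a * b \<le> c \<longleftrightarrow> b \<le> a * c"
proof
  have eq: "a * (inverse a * b) = b" "inverse a * (a * c) = c"
    using inverse_mult_self[OF assms] by (metis mult.assoc mult.commute mult_1)+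
  show "b \<le> a * c" if "inverse a * b \<le> c"
    using mult_left_mono[OF that zero_le, of a] eq by simp
  show "inverse a * b \<le> c" if "b \<le> a * c"
    using mult_left_mono[OF that zero_le, of "inverse a"] eq by simp
qed

lemma semifield_inverse_nonzero:
  fixes a :: "'a::idempotent_semifield"
  assumes "a \<noteq> 0"
  shows "inverse a \<noteq> 0"
  using inverse_mult_self[OF assms] assms by (metis mult_1 mult_zero_left)

lemma semifield_mult_nonzero:
  fixes a b :: "'a::idempotent_semifield"
  assumes "a \<noteq> 0" "b \<noteq> 0"
  shows "a * b \<noteq> 0"
  using semifield_mult_right_cancel[of b a 0] assms by auto

lemma inverse_inverse_semifield:
  fixes a :: "'a::idempotent_semifield"
  assumes "a \<noteq> 0"
  shows "inverse (inverse a) = a"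
  using inverse_mult_self[OF assms] inverse_mult_self[OF semifield_inverse_nonzero[OF assms]]
  by (metis mult.assoc mult.commute mult_1)

lemma inverse_power_mult_power:
  fixes a :: "'a::idempotent_semifield"
  assumes "a \<noteq> 0"
  shows "inverse a ^ k * a ^ k = 1"
  using inverse_mult_self[OF assms] by (simp flip: power_mult_distrib)

lemma inverse_power_mult_le_iff:
  fixes a b c :: "'a::idempotent_semifield"
  assumes "a \<noteq> 0"
  shows "inverse a ^ k * b \<le> c \<longleftrightarrow> b \<le> a ^ k * c"
proof -
  have "inverse (a ^ k) = inverse a ^ k"
    using inverse_power_mult_power[OF assms, of k]
      inverse_mult_self[OF semifield_power_nonzero[OF assms], of k]
      semifield_mult_right_cancel[OF semifield_power_nonzero[OF assms]] by metis
  then show ?thesis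
    using inverse_mult_le_iff[OF semifield_power_nonzero[OF assms], of k b c] by simp
qed

lemma nth_root_le_iff:
  fixes x z :: "'a::radicable_linear_semifield"
  assumes "0 < n"
  shows "nth_root n x \<le> z \<longleftrightarrow> x \<le> z ^ n"
proof
  show "x \<le> z ^ n" if "nth_root n x \<le> z"
    using semifield_power_mono[OF that, of n] nth_root_power[OF assms, of x] by simp
  show "nth_root n x \<le> z" if "x \<le> z ^ n"
  proof (rule ccontr)
    assume "\<not> nth_root n x \<le> z"
    then have "z < nth_root n x" by simp
    then have "z ^ n \<le> x" "z ^ n \<noteq> x"
      using semifield_power_mono[of z "nth_root n x" n] nth_root_power[OF assms, of x]
        semifield_power_less_imp_neq[OF assms, of z "nth_root n x"] by auto
    with that show False by simp
  qed
qed


section \<open>Monotone vector and matrix products\<close>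

lemma matrix_vector_mult_mono:
  fixes A B :: "'a::idempotent_semifield ^ 'n ^ 'm"
  assumes "A \<le> B" "x \<le> y"
  shows "A *v x \<le> B *v y"
  using assms unfolding less_eq_vec_def matrix_vector_mult_def
  by (auto intro!: sum_mono mult_mono)

lemma matrix_mult_mono:
  fixes A B :: "'a::idempotent_semifield ^ 'n ^ 'm"
  assumes "A \<le> B" "C \<le> D"
  shows "A ** C \<le> B ** D"
  using assms unfolding less_eq_vec_def matrix_matrix_mult_def
  by (auto intro!: sum_mono mult_mono)

lemma vector_scalar_mult_mono:
  fixes x y :: "'a::idempotent_semifield ^ 'n"
  assumes "a \<le> b" "x \<le> y"
  shows "a *s x \<le> b *s y"
  using assms by (auto simp: less_eq_vec_def intro!: mult_mono)

lemma inverse_smult_le_iff: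
  fixes x y :: "'a::idempotent_semifield ^ 'n"
  assumes "a \<noteq> 0"
  shows "inverse a *s x \<le> y \<longleftrightarrow> x \<le> a *s y"
  by (simp add: less_eq_vec_def inverse_mult_le_iff[OF assms])

lemma matrix_vector_mult_smult:
  fixes A :: "'a::comm_semiring_1 ^ 'n ^ 'm"
  shows "A *v (c *s x) = c *s (A *v x)"
  by (simp add: vec_eq_iff matrix_vector_mult_def sum_distrib_left mult_ac)

lemma scale_mat_mult_vector:
  fixes A :: "'a::comm_semiring_1 ^ 'n ^ 'm"
  shows "scale_mat c A *v x = c *s (A *v x)"
  by (simp add: vec_eq_iff scale_mat_def matrix_vector_mult_def sum_distrib_left mult_ac)

lemma row_col_smult_right: "row_col y (c *s x) = c * row_col y x"
  by (simp add: row_col_def sum_distrib_left mult_ac)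

lemma row_col_matrix_vector_mult: "row_col y (M *v x) = row_col (y v* M) x"
  unfolding row_col_def matrix_vector_mult_def vector_matrix_mult_def
  by (simp add: sum_distrib_left sum_distrib_right mult_ac) (rule sum.swap)


section \<open>Residuation by conjugate transposition\<close>

text \<open>A product with a conjugate is a maximum of quotients, so bounding it by \<open>s\<close> bounds each
  entry separately. All three vector terms of the objective, and the upper bound on \<open>u\<close> in the
  parametrisation of the solutions, are resolved in this way.\<close>

lemma row_col_conj_transpose_le_iff:
  fixes x y :: "'a::idempotent_semifield ^ 'n"
  assumes "regular x"
  shows "row_col (conj_transpose x) y \<le> s \<longleftrightarrow> y \<le> s *s x"
  using assms
  by (simp add: row_col_def conj_transpose_def regular_def semifield_sum_le_iff less_eq_vec_def
      inverse_mult_le_iff mult.commute[of s])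

lemma regular_conj_transpose:
  fixes x :: "'a::idempotent_semifield ^ 'n"
  assumes "regular x"
  shows "regular (conj_transpose x)"
  using assms by (simp add: regular_def conj_transpose_def semifield_inverse_nonzero)

lemma conj_transpose_conj_transpose:
  fixes x :: "'a::idempotent_semifield ^ 'n"
  assumes "regular x"
  shows "conj_transpose (conj_transpose x) = x"
  using assms
  by (simp add: vec_eq_iff regular_def conj_transpose_def semifield_inverse_nonzero
      inverse_inverse_semifield)

lemma row_col_le_iff:
  fixes r x :: "'a::idempotent_semifield ^ 'n"
  assumes "regular r"
  shows "row_col r x \<le> s \<longleftrightarrow> x \<le> s *s conj_transpose r"
  using row_col_conj_transpose_le_iff[OF regular_conj_transpose[OF assms], of x s]
  by (simp add: conj_transpose_conj_transpose[OF assms])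

lemma regular_mono:
  fixes x y :: "'a::idempotent_semifield ^ 'n"
  assumes "regular x" "x \<le> y"
  shows "regular y"
  using assms unfolding regular_def less_eq_vec_def by (metis le_zero_eq)

lemma objective_le_iff:
  fixes x :: "'a::idempotent_semifield ^ 'n"
  assumes "regular x" "regular q"
  shows "objective A p q c x \<le> \<theta>
    \<longleftrightarrow> A *v x \<le> \<theta> *s x \<and> p \<le> \<theta> *s x \<and> x \<le> \<theta> *s q \<and> c \<le> \<theta>"
  using assms by (simp add: objective_def semifield_add_le_iff row_col_conj_transpose_le_iff)

text \<open>Scale \<open>x\<close> until it just dominates an eigenvector \<open>v\<close>. At an entry where the two touch,
  applying \<open>A\<close> multiplies \<open>v\<close> by the eigenvalue and the scaled \<open>x\<close> by at most \<open>s\<close>.\<close>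

lemma eigenvalue_le:
  fixes A :: "'a::radicable_linear_semifield ^ 'n ^ 'n"
  assumes "eigenvalue A l" "regular x" "A *v x \<le> s *s x"
  shows "l \<le> s"
proof -
  obtain v where v: "v \<noteq> 0" "A *v v = l *s v"
    using assms(1) unfolding eigenvalue_def by blast
  define t where "t = row_col (conj_transpose x) v"
  have le: "v \<le> t *s x"
    using row_col_conj_transpose_le_iff[OF assms(2), of v t] by (simp add: t_def)
  obtain i where "t = conj_transpose x $ i * v $ i"
    using semifield_sum_attained[of UNIV "\<lambda>i. conj_transpose x $ i * v $ i"]
    by (auto simp: t_def row_col_def)
  then have i: "v $ i = t * x $ i"
    using assms(2) inverse_mult_self[of "x $ i"]
    by (simp add: conj_transpose_def regular_def mult_ac)
  have t: "t \<noteq> 0"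
    using v(1) le by (auto simp: vec_eq_iff less_eq_vec_def)
  then have vi: "v $ i \<noteq> 0"
    using i assms(2) semifield_mult_nonzero[of t "x $ i"] by (simp add: regular_def)
  have "l *s v \<le> t *s (A *v x)"
    using matrix_vector_mult_mono[OF order.refl le, of A] v(2)
    by (simp add: matrix_vector_mult_smult)
  also have "\<dots> \<le> t *s (s *s x)"
    by (intro vector_scalar_mult_mono order.refl assms(3))
  finally have "l * v $ i \<le> t * (s * x $ i)"
    by (simp add: less_eq_vec_def mult.assoc)
  then have "l * v $ i \<le> s * v $ i"
    by (simp add: i mult_ac)
  then have "inverse (v $ i) * (v $ i * l) \<le> s"
    using inverse_mult_le_iff[OF vi, of "v $ i * l" s] by (simp add: mult.commute[of _ "v $ i"])
  then show ?thesis
    using inverse_mult_self[OF vi] by (simp flip: mult.assoc)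
qed


section \<open>Powers and the star of a matrix\<close>

lemma mat_pow_add: "mat_pow A (s + t) = mat_pow A s ** mat_pow A t"
  by (induction t) (simp_all add: matrix_mul_assoc)

lemma mat_pow_Suc_left: "mat_pow A (Suc k) = A ** mat_pow A k"
  using mat_pow_add[of A 1 k] by simp

lemma mat_pow_scale_mat:
  fixes A :: "'a::comm_semiring_1 ^ 'n ^ 'n"
  shows "mat_pow (scale_mat c A) k = scale_mat (c ^ k) (mat_pow A k)"
proof (induction k)
  case (Suc k)
  have "scale_mat a M ** scale_mat b N = scale_mat (a * b) (M ** N)"
    for a b :: 'a and M N :: "'a ^ 'n ^ 'n"
    by (simp add: vec_eq_iff scale_mat_def matrix_matrix_mult_def sum_distrib_left mult_ac)
  then show ?case by (simp add: Suc mult.commute)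
qed (simp add: vec_eq_iff scale_mat_def)

lemma mat_pow_mult_le:
  fixes A :: "'a::idempotent_semifield ^ 'n ^ 'n"
  assumes "A *v x \<le> s *s x"
  shows "mat_pow A k *v x \<le> s ^ k *s x"
proof (induction k)
  case (Suc k)
  have "mat_pow A (Suc k) *v x = mat_pow A k *v (A *v x)"
    by (simp add: matrix_vector_mul_assoc)
  also have "\<dots> \<le> mat_pow A k *v (s *s x)"
    by (intro matrix_vector_mult_mono order.refl assms)
  also have "\<dots> = s *s (mat_pow A k *v x)"
    by (rule matrix_vector_mult_smult)
  also have "\<dots> \<le> s *s (s ^ k *s x)"
    by (intro vector_scalar_mult_mono order.refl Suc)
  finally show ?case by (simp add: vector_smult_assoc)
qed simp

lemma mat_star_entry: "mat_star A $ i $ j = (\<Sum>k<CARD('n). mat_pow A k $ i $ j)"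
  for A :: "'a::semiring_1 ^ 'n ^ 'n"
  by (simp add: mat_star_def)

lemma mat_pow_le_mat_star:
  fixes A :: "'a::idempotent_semifield ^ 'n ^ 'n"
  assumes "k < CARD('n)"
  shows "mat_pow A k \<le> mat_star A"
  using semifield_sum_upper[of "{..<CARD('n)}" k] assms
  by (auto simp: less_eq_vec_def mat_star_entry)

lemma one_le_mat_star_diag:
  fixes A :: "'a::idempotent_semifield ^ 'n ^ 'n"
  shows "1 \<le> mat_star A $ i $ i"
proof -
  have "mat_pow A 0 $ i $ i \<le> mat_star A $ i $ i"
    using mat_pow_le_mat_star[of 0 A] unfolding less_eq_vec_def by simp
  then show ?thesis by (simp add: mat_def)
qed

lemma mat_star_mult_vector:
  fixes A :: "'a::semiring_1 ^ 'n ^ 'n"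
  shows "mat_star A *v x = (\<Sum>k<CARD('n). mat_pow A k *v x)"
  by (simp add: vec_eq_iff matrix_vector_mult_def mat_star_entry sum_distrib_right)
    (intro allI sum.swap)

lemma mat_star_mult_vector_le_iff:
  fixes A :: "'a::idempotent_semifield ^ 'n ^ 'n"
  shows "mat_star A *v x \<le> y \<longleftrightarrow> (\<forall>k<CARD('n). mat_pow A k *v x \<le> y)"
  by (auto simp: mat_star_mult_vector less_eq_vec_def semifield_sum_le_iff)

lemma le_mat_star_mult_vector:
  fixes A :: "'a::idempotent_semifield ^ 'n ^ 'n"
  shows "x \<le> mat_star A *v x"
  using matrix_vector_mult_mono[OF mat_pow_le_mat_star[of 0 A] order.refl, of x] by simp

lemma mat_star_mult_vector_eq:
  fixes A :: "'a::idempotent_semifield ^ 'n ^ 'n"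
  assumes "A *v x \<le> x"
  shows "mat_star A *v x = x"
proof (rule order.antisym[OF _ le_mat_star_mult_vector])
  show "mat_star A *v x \<le> x"
    using mat_pow_mult_le[of A x 1] assms by (simp add: mat_star_mult_vector_le_iff)
qed


section \<open>Walks and cycles\<close>

lemma walk_weight_le_mat_pow:
  fixes A :: "'a::idempotent_semifield ^ 'n ^ 'n"
  shows "(\<Prod>l<k. A $ w (s + l) $ w (Suc (s + l))) \<le> mat_pow A k $ w s $ w (s + k)"
proof (induction k)
  case (Suc k)
  have "(\<Prod>l<Suc k. A $ w (s + l) $ w (Suc (s + l)))
      \<le> mat_pow A k $ w s $ w (s + k) * A $ w (s + k) $ w (Suc (s + k))"
    using semifield_mult_right_mono[OF Suc] by simp
  also have "\<dots> \<le> (\<Sum>i\<in>UNIV. mat_pow A k $ w s $ i * A $ i $ w (Suc (s + k)))"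
    by (rule semifield_sum_upper) auto
  finally show ?case by (simp add: matrix_matrix_mult_def)
qed (simp add: mat_def)

text \<open>The first disjunct is the one case without any walk: zero steps between distinct vertices,
  where the power has entry \<open>0\<close>.\<close>

lemma mat_pow_eq_walk_weight:
  fixes A :: "'a::radicable_linear_semifield ^ 'n ^ 'n"
  shows "\<exists>w. k = 0 \<and> i \<noteq> j \<or>
    w 0 = i \<and> w k = j \<and> mat_pow A k $ i $ j = (\<Prod>l<k. A $ w l $ w (Suc l))"
proof (induction k arbitrary: j)
  case 0
  show ?case by (auto simp: mat_def)
next
  case (Suc k)
  show ?case
  proof (cases k)
    case 0
    then show ?thesis
      by (intro exI[of _ "\<lambda>l. if l = 0 then i else j"]) simp
  next
    case k: (Suc k')
    obtain h where h: "mat_pow A (Suc k) $ i $ j = mat_pow A k $ i $ h * A $ h $ j"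
      using semifield_sum_attained[of UNIV "\<lambda>h. mat_pow A k $ i $ h * A $ h $ j"]
      by (auto simp: matrix_matrix_mult_def)
    obtain w where w: "w 0 = i" "w k = h"
        "mat_pow A k $ i $ h = (\<Prod>l<k. A $ w l $ w (Suc l))"
      using Suc[of h] k by auto
    have "(\<Prod>l<k. A $ w l $ w (Suc l))
        = (\<Prod>l<k. A $ (w(Suc k := j)) l $ (w(Suc k := j)) (Suc l))"
      by (rule prod.cong) auto
    then show ?thesis
      using w h by (intro exI[of _ "w(Suc k := j)"]) (simp del: mat_pow.simps)
  qed
qed

text \<open>A walk with as many steps as there are vertices contains a cycle, by the pigeonhole principle
  applied to the \<open>n + 1\<close> visits of vertices. Cutting out a cycle of weight at most \<open>1\<close> does not
  decrease the weight of the walk, and leaves a walk that the star already accounts for. The only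
  case that needs this is \<open>k = n\<close>, the first power that the star does not contain.\<close>

lemma mat_pow_le_star:
  fixes A :: "'a::radicable_linear_semifield ^ 'n ^ 'n"
  assumes cyc: "\<And>m i. 1 \<le> m \<Longrightarrow> m \<le> CARD('n) \<Longrightarrow> mat_pow A m $ i $ i \<le> 1"
    and "k \<le> CARD('n)"
  shows "mat_pow A k \<le> mat_star A"
proof (cases "k < CARD('n)")
  case True
  then show ?thesis by (rule mat_pow_le_mat_star)
next
  case False
  then have k: "k = CARD('n)" using assms(2) by simp
  show ?thesis unfolding less_eq_vec_def
  proof (intro allI)
    fix i j
    obtain w where w: "w 0 = i" "w k = j" "mat_pow A k $ i $ j = (\<Prod>l<k. A $ w l $ w (Suc l))"
      using mat_pow_eq_walk_weight[of k i j A] k by auto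
    have "\<not> inj_on w {..k}"
    proof
      assume "inj_on w {..k}"
      then have "card {..k} \<le> CARD('n)"
        by (metis card_image card_mono finite top_greatest)
      then show False using k by simp
    qed
    then obtain s t where st: "s < t" "t \<le> k" "w s = w t"
      by (auto simp: inj_on_def) (metis linorder_neqE_nat)
    \<comment> \<open>the walk consists of the first \<open>s\<close> steps, a cycle of \<open>m\<close> steps and the last \<open>r\<close> steps\<close>
    obtain m where m: "t = s + m" "1 \<le> m" using st(1) less_imp_add_positive[of s t] by auto
    obtain r where r: "k = s + m + r" using st(2) m by (metis le_iff_add)
    define W where "W a b = (\<Prod>l<b. A $ w (a + l) $ w (Suc (a + l)))" for a b
    have W_add: "W a (b + d) = W a b * W (a + b) d" for a b d
      by (induction d) (simp_all add: W_def mult_ac add_ac)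
    have W_le: "W a b \<le> mat_pow A b $ w a $ w (a + b)" for a b
      unfolding W_def by (rule walk_weight_le_mat_pow)
    have "W s m \<le> 1"
      using W_le[of s m] cyc[of m "w s"] m st k r by (metis le_add2 le_add1 order.trans)
    have "mat_pow A k $ i $ j = W 0 s * W s m * W t r"
      using w(3) W_add[of 0 s "m + r"] W_add[of s m r] r m(1)
      by (simp add: W_def mult_ac add_ac)
    also have "\<dots> \<le> W 0 s * 1 * W t r"
      by (intro mult_mono order.refl zero_le \<open>W s m \<le> 1\<close>)
    also have "\<dots> \<le> mat_pow A s $ i $ w s * mat_pow A r $ w s $ j"
      using W_le[of 0 s] W_le[of t r] w(1,2) st(3) r m(1) by (auto intro!: mult_mono)
    also have "\<dots> \<le> mat_pow A (s + r) $ i $ j"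
      unfolding mat_pow_add matrix_matrix_mult_def
      using semifield_sum_upper[of UNIV "w s" "\<lambda>h. mat_pow A s $ i $ h * mat_pow A r $ h $ j"]
      by simp
    also have "\<dots> \<le> mat_star A $ i $ j"
      using mat_pow_le_mat_star[of "s + r" A] r m k by (simp add: less_eq_vec_def)
    finally show "mat_pow A k $ i $ j \<le> mat_star A $ i $ j" .
  qed
qed

lemma mat_star_matrix_eq: "M ** mat_star A = (\<Sum>k<CARD('n). M ** mat_pow A k)"
  for M A :: "'a::comm_semiring_1 ^ 'n ^ 'n"
  by (simp add: vec_eq_iff matrix_matrix_mult_def mat_star_entry sum_distrib_left)
    (intro allI sum.swap)

lemma matrix_mult_star_le:
  fixes A :: "'a::radicable_linear_semifield ^ 'n ^ 'n"
  assumes "\<And>m i. 1 \<le> m \<Longrightarrow> m \<le> CARD('n) \<Longrightarrow> mat_pow A m $ i $ i \<le> 1"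
  shows "A ** mat_star A \<le> mat_star A"
proof -
  have "A ** mat_pow A k \<le> mat_star A" if "k < CARD('n)" for k
    using mat_pow_le_star[OF assms, of "Suc k"] that by (simp only: mat_pow_Suc_left Suc_le_eq)
  then show ?thesis
    by (auto simp: mat_star_matrix_eq less_eq_vec_def semifield_sum_le_iff)
qed

text \<open>The bound on cycles that replaces the trace formula for the spectral radius. Let \<open>\<kappa>\<close> be the
  maximal mean of a closed walk with at most \<open>n\<close> steps, attained by one through \<open>i\<close>. The case
  \<open>\<kappa> = 0\<close> being trivial, let \<open>C = \<kappa>^(-1) A\<close>. Then \<open>C C*\<close> and \<open>C*\<close> agree in column \<open>i\<close>: since
  \<open>C C* \<le> C*\<close>, they can differ only in that \<open>C C*\<close> lacks the empty walk at \<open>i\<close>, and the critical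
  closed walk, of weight \<open>1\<close>, makes up for it. So this column is an eigenvector of \<open>A\<close> with
  eigenvalue \<open>\<kappa>\<close>.\<close>

lemma cycle_weight_le:
  fixes A :: "'a::radicable_linear_semifield ^ 'n ^ 'n"
  assumes bound: "\<And>k. eigenvalue A k \<Longrightarrow> k \<le> l"
    and "1 \<le> m" "m \<le> CARD('n)"
  shows "mat_pow A m $ j $ j \<le> l ^ m"
proof -
  define f where "f = (\<lambda>(m, i). nth_root m (mat_pow A m $ i $ i))"
  define S where "S = {1..CARD('n)} \<times> (UNIV :: 'n set)"
  define \<kappa> where "\<kappa> = sum f S"
  have S: "finite S" "S \<noteq> {}" by (auto simp: S_def)
  have le: "mat_pow A k $ i $ i \<le> \<kappa> ^ k" if "1 \<le> k" "k \<le> CARD('n)" for k i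
    using semifield_sum_upper[OF S(1), of "(k, i)" f] nth_root_le_iff[of k] that
    by (auto simp: \<kappa>_def f_def S_def)
  have "\<kappa> \<le> l"
  proof (cases "\<kappa> = 0")
    case False
    obtain k i where ki: "1 \<le> k" "k \<le> CARD('n)" "\<kappa> = nth_root k (mat_pow A k $ i $ i)"
      using semifield_sum_attained[OF S, of f] by (auto simp: S_def \<kappa>_def f_def)
    define C where "C = scale_mat (inverse \<kappa>) A"
    define v where "v = (\<chi> j. mat_star C $ j $ i)"
    have powC: "mat_pow C k $ a $ b = inverse \<kappa> ^ k * mat_pow A k $ a $ b" for k a b
      unfolding C_def mat_pow_scale_mat by (simp add: scale_mat_def)
    have cyc: "mat_pow C k $ i $ i \<le> 1" if "1 \<le> k" "k \<le> CARD('n)" for k i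
      using le[OF that] inverse_power_mult_le_iff[OF False] by (simp add: powC)
    have crit: "mat_pow C k $ i $ i = 1"
      using ki nth_root_power[of k "mat_pow A k $ i $ i"] inverse_power_mult_power[OF False, of k]
      by (simp add: powC)
    have Suc_le: "mat_pow C (Suc k) \<le> C ** mat_star C" if "k < CARD('n)" for k
      unfolding mat_pow_Suc_left by (intro matrix_mult_mono order.refl mat_pow_le_mat_star that)
    have Cv: "(C *v v) $ j = (C ** mat_star C) $ j $ i" for j
      by (simp add: v_def matrix_vector_mult_def matrix_matrix_mult_def)
    have "C *v v = v"
    proof (rule order.antisym)
      show "C *v v \<le> v"
        using matrix_mult_star_le[OF cyc] by (simp add: less_eq_vec_def Cv) (simp add: v_def)
      have "mat_pow C k' $ j $ i \<le> (C ** mat_star C) $ j $ i" if "k' < CARD('n)" for k' j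
      proof (cases k')
        case 0
        have "1 \<le> (C ** mat_star C) $ i $ i"
          using Suc_le[of "k - 1"] ki crit unfolding less_eq_vec_def
          by (metis Suc_diff_1 less_eq_Suc_le less_le_trans One_nat_def diff_less zero_less_one)
        then show ?thesis by (auto simp: 0 mat_def)
      next
        case (Suc k'')
        then show ?thesis using Suc_le[of k''] that by (simp add: less_eq_vec_def)
      qed
      then show "v \<le> C *v v"
        by (simp add: less_eq_vec_def Cv) (simp add: v_def mat_star_entry semifield_sum_le_iff)
    qed
    then have "A *v v = \<kappa> *s v"
      using inverse_mult_self[OF False]
      by (simp add: C_def scale_mat_mult_vector)
        (metis mult.commute vector_smult_assoc vector_smult_lid)
    moreover have "v \<noteq> 0"
    proof
      assume "v = 0"
      then have "mat_star C $ i $ i = 0" by (simp add: v_def vec_eq_iff)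
      then show False
        using one_le_mat_star_diag[of C i] by simp
    qed
    ultimately show ?thesis using bound unfolding eigenvalue_def by blast
  qed simp
  then show ?thesis
    using le[OF assms(2,3)] semifield_power_mono[of \<kappa> l m] order.trans by blast
qed


section \<open>The constrained minimization problem\<close>

theorem theorem5:
  fixes A :: "'a::radicable_linear_semifield ^ 'n ^ 'n"
    and p q :: "'a ^ 'n"
    and c lam \<mu> :: 'a
  assumes "is_spectral_radius A lam"
    and "0 < lam"
    and "regular q"
    and "\<mu> = lam
          + (\<Sum>m = 1..CARD('n).
               nth_root (m + 1) (row_col (conj_transpose q) (mat_pow A (m - 1) *v p)))
          + c"
  shows "(\<exists>x. regular x \<and> objective A p q c x = \<mu>)
    \<and> (\<forall>x. regular x \<longrightarrow> \<mu> \<le> objective A p q c x)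
    \<and> (\<forall>x. regular x \<longrightarrow>
          (objective A p q c x = \<mu> \<longleftrightarrow>
            (\<exists>u. inverse \<mu> *s p \<le> u
               \<and> u \<le> \<mu> *s conj_transpose
                          (conj_transpose q v* mat_star (scale_mat (inverse \<mu>) A))
               \<and> x = mat_star (scale_mat (inverse \<mu>) A) *v u)))"
proof -
  define B where "B = scale_mat (inverse \<mu>) A"
  define r where "r = conj_transpose q v* mat_star B"
  have eig: "eigenvalue A lam" "\<And>k. eigenvalue A k \<Longrightarrow> k \<le> lam"
    using assms(1) unfolding is_spectral_radius_def by auto
  have mu_le_iff: "\<mu> \<le> \<theta> \<longleftrightarrow> lam \<le> \<theta> \<and> c \<le> \<theta> \<and> (\<forall>m\<in>{1..CARD('n)}.
      row_col (conj_transpose q) (mat_pow A (m - 1) *v p) \<le> \<theta> ^ (m + 1))" for \<theta>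
    by (auto simp: assms(4) semifield_add_le_iff semifield_sum_le_iff nth_root_le_iff)
  have lam_le: "lam \<le> \<mu>" and c_le: "c \<le> \<mu>"
    and root_le: "\<And>m. m \<in> {1..CARD('n)} \<Longrightarrow>
      row_col (conj_transpose q) (mat_pow A (m - 1) *v p) \<le> \<mu> ^ (m + 1)"
    using mu_le_iff[of \<mu>] by auto
  have mu: "\<mu> \<noteq> 0" using assms(2) lam_le by auto

  have lower: "\<mu> \<le> objective A p q c x" if x: "regular x" for x
  proof -
    define \<theta> where "\<theta> = objective A p q c x"
    have sys: "A *v x \<le> \<theta> *s x" "p \<le> \<theta> *s x" "x \<le> \<theta> *s q" "c \<le> \<theta>"
      using objective_le_iff[OF x assms(3), of A p c \<theta>] by (auto simp: \<theta>_def)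
    have "mat_pow A (m - 1) *v p \<le> \<theta> ^ (m + 1) *s q" if "1 \<le> m" for m
    proof -
      have "mat_pow A (m - 1) *v p \<le> mat_pow A (m - 1) *v (\<theta> *s x)"
        by (intro matrix_vector_mult_mono order.refl sys)
      also have "\<dots> = \<theta> *s (mat_pow A (m - 1) *v x)"
        by (rule matrix_vector_mult_smult)
      also have "\<dots> \<le> \<theta> *s (\<theta> ^ (m - 1) *s (\<theta> *s q))"
        using order.trans[OF mat_pow_mult_le[OF sys(1)]
            vector_scalar_mult_mono[OF order.refl sys(3)]]
        by (intro vector_scalar_mult_mono order.refl)
      also have "\<dots> = \<theta> ^ (m + 1) *s q"
        using that by (cases m) (simp_all add: vector_smult_assoc mult_ac)
      finally show ?thesis .
    qed
    then show ?thesis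
      using eigenvalue_le[OF eig(1) x sys(1)] sys(4)
      by (fold \<theta>_def) (simp add: mu_le_iff row_col_conj_transpose_le_iff[OF assms(3)])
  qed

  have optimal_iff: "objective A p q c x = \<mu>
      \<longleftrightarrow> B *v x \<le> x \<and> inverse \<mu> *s p \<le> x \<and> row_col (conj_transpose q) x \<le> \<mu>"
    if x: "regular x" for x
    using lower[OF x] objective_le_iff[OF x assms(3), of A p c \<mu>] c_le
    by (auto simp: B_def scale_mat_mult_vector inverse_smult_le_iff[OF mu]
        row_col_conj_transpose_le_iff[OF assms(3)])

  have powB: "mat_pow B k = scale_mat (inverse \<mu> ^ k) (mat_pow A k)" for k
    by (simp add: B_def mat_pow_scale_mat)
  have cycB: "mat_pow B m $ i $ i \<le> 1" if "1 \<le> m" "m \<le> CARD('n)" for m i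
    using order.trans[OF cycle_weight_le[OF eig(2) that] semifield_power_mono[OF lam_le]]
    by (simp add: powB scale_mat_def inverse_power_mult_le_iff[OF mu])
  have star_sol: "B *v (mat_star B *v u) \<le> mat_star B *v u" for u
    using matrix_vector_mult_mono[OF matrix_mult_star_le[OF cycB] order.refl, of u]
    by (simp add: matrix_vector_mul_assoc)

  have r_regular: "regular r"
  proof (rule regular_mono[OF regular_conj_transpose[OF assms(3)]])
    have "conj_transpose q $ i \<le> r $ i" for i
    proof -
      have "1 \<le> mat_star B $ i $ i"
        by (rule one_le_mat_star_diag)
      then have "1 * conj_transpose q $ i \<le> mat_star B $ i $ i * conj_transpose q $ i"
        by (rule semifield_mult_right_mono)
      also have "\<dots> \<le> r $ i"
        using semifield_sum_upper[of UNIV i "\<lambda>j. mat_star B $ j $ i * conj_transpose q $ j"]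
        by (simp add: r_def vector_matrix_mult_def mult.commute)
      finally show ?thesis by simp
    qed
    then show "conj_transpose q \<le> r" by (simp add: less_eq_vec_def)
  qed
  have upper_iff: "u \<le> \<mu> *s conj_transpose r
      \<longleftrightarrow> row_col (conj_transpose q) (mat_star B *v u) \<le> \<mu>" for u
    using row_col_le_iff[OF r_regular, of u \<mu>] by (simp add: r_def row_col_matrix_vector_mult)

  have optimal_star: "objective A p q c (mat_star B *v u) = \<mu>"
    if "inverse \<mu> *s p \<le> u" "u \<le> \<mu> *s conj_transpose r" "regular (mat_star B *v u)" for u
    using optimal_iff[OF that(3)] star_sol upper_iff that le_mat_star_mult_vector order.trans
    by metis

  \<comment> \<open>the upper bound itself is a feasible and regular choice of \<open>u\<close>\<close>
  define u0 where "u0 = \<mu> *s conj_transpose r"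
  have "regular u0"
    using regular_conj_transpose[OF r_regular] mu
    by (simp add: u0_def regular_def semifield_mult_nonzero)
  then have x0_regular: "regular (mat_star B *v u0)"
    by (rule regular_mono) (rule le_mat_star_mult_vector)
  have "row_col (conj_transpose q) (mat_pow B k *v (inverse \<mu> *s p)) \<le> \<mu>" if "k < CARD('n)" for k
  proof -
    have "row_col (conj_transpose q) (mat_pow B k *v (inverse \<mu> *s p))
        = inverse \<mu> ^ Suc k * row_col (conj_transpose q) (mat_pow A k *v p)"
      by (simp add: powB scale_mat_mult_vector matrix_vector_mult_smult row_col_smult_right mult_ac)
    also have "\<dots> \<le> \<mu>"
      using root_le[of "Suc k"] that
      by (simp add: inverse_power_mult_le_iff[OF mu] mult_ac del: power_Suc) (simp add: mult_ac)
    finally show ?thesis .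
  qed
  then have "inverse \<mu> *s p \<le> u0"
    by (simp add: u0_def upper_iff row_col_conj_transpose_le_iff[OF assms(3)]
        mat_star_mult_vector_le_iff)
  then have attained: "objective A p q c (mat_star B *v u0) = \<mu>"
    using optimal_star[of u0] x0_regular by (simp add: u0_def)

  have "objective A p q c x = \<mu> \<longleftrightarrow> (\<exists>u. inverse \<mu> *s p \<le> u
      \<and> u \<le> \<mu> *s conj_transpose r \<and> x = mat_star B *v u)" if x: "regular x" for x
  proof
    assume "objective A p q c x = \<mu>"
    then have sys: "B *v x \<le> x" "inverse \<mu> *s p \<le> x" "row_col (conj_transpose q) x \<le> \<mu>"
      using optimal_iff[OF x] by auto
    then show "\<exists>u. inverse \<mu> *s p \<le> u \<and> u \<le> \<mu> *s conj_transpose r \<and> x = mat_star B *v u"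
      using upper_iff[of x] mat_star_mult_vector_eq[OF sys(1)] by (intro exI[of _ x]) auto
  next
    assume "\<exists>u. inverse \<mu> *s p \<le> u \<and> u \<le> \<mu> *s conj_transpose r \<and> x = mat_star B *v u"
    then show "objective A p q c x = \<mu>" using optimal_star x by auto
  qed
  then show ?thesis
    using lower x0_regular attained by (fold B_def r_def) blast
qed

end
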